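(* Let $\mathbb{K}=\mathbb{R}$ or $\mathbb{K}=\mathbb{C}$, and let $\mathbf{a}=(a_i)_{i\ge 1}$, $\mathbf{b}=(b_i)_{i\ge 1}$, $\mathbf{x}=(x_i)_{i\ge 1}$ belong to $\ell^{2}(\mathbb{K})$, with $\mathbf{a},\mathbf{b}$ linearly independent and $$\sum_{i=1}^{\infty}x_i\overline{a_i}=0,\qquad \sum_{i=1}^{\infty}|x_i|^{2}=1.$$ Then $$\frac{\sum_{i=1}^{\infty}|a_i|^{2}\sum_{i=1}^{\infty}|b_i|^{2}-\left|\sum_{i=1}^{\infty}a_i\overline{b_i}\right|^{2}}{\sum_{i=1}^{\infty}|a_i|^{2}}\ \geq\ \left|\sum_{i=1}^{\infty}x_i\overline{b_i}\right|^{2}.$$ Moreover, equality holds in this inequality if and only if there is a scalar $\nu\in\mathbb{K}$ with $$|\nu|=\frac{\left(\sum_{k=1}^{\infty}|a_k|^{2}\right)^{1/2}}{\left[\sum_{k=1}^{\infty}|a_k|^{2}\sum_{k=1}^{\infty}|b_k|^{2}-\left|\sum_{k=1}^{\infty}a_k\overline{b_k}\right|^{2}\right]^{1/2}}$$ such that $$x_i=\nu\left[b_i-\frac{\sum_{k=1}^{\infty}\overline{a_k}\,b_k}{\sum_{k=1}^{\infty}|a_k|^{2}}\,a_i\right]\quad\text{for all } i\in\{1,2,\dots\}.$$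
   Context: $\ell^{2}(\mathbb{K})$ is the space of sequences $(x_i)_{i\ge 1}$ in $\mathbb{K}$ with $\sum_{i=1}^{\infty}|x_i|^{2}<\infty$. *)

theory Defs
  imports Complex_Main
begin

text \<open>
  The scalar field is a set \<open>K\<close> of complex numbers, meant to be \<open>\<real>\<close> or \<open>UNIV\<close>; for \<open>K = \<real>\<close>
  conjugation and modulus restrict to the identity and the absolute value.
  Sequences are indexed from \<open>0\<close>.
\<close>

definition ell2 :: "complex set \<Rightarrow> (nat \<Rightarrow> complex) set" where
  "ell2 K = {x. (\<forall>i. x i \<in> K) \<and> summable (\<lambda>i. (cmod (x i))\<^sup>2)}"

definition lin_indep_pair :: "complex set \<Rightarrow> (nat \<Rightarrow> complex) \<Rightarrow> (nat \<Rightarrow> complex) \<Rightarrow> bool" where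
  "lin_indep_pair K a b \<longleftrightarrow>
     (\<forall>c\<in>K. \<forall>d\<in>K. (\<forall>i. c * a i + d * b i = 0) \<longrightarrow> c = 0 \<and> d = 0)"

end

(*
  Let c be the component of b orthogonal to a. Its squared norm is |b|^2 - |<a,b>|^2 / |a|^2, which
  is the left-hand side of the inequality, and <x,b> = <x,c> because x is orthogonal to a. So the
  claim is Cauchy-Schwarz for x and c, where equality means that x equals its projection on c.
*)
theory Submission
  imports Defs
begin

definition square_summable :: "(nat \<Rightarrow> complex) \<Rightarrow> bool" where
  "square_summable u \<longleftrightarrow> summable (\<lambda>i. (cmod (u i))\<^sup>2)"

definition sq_norm :: "(nat \<Rightarrow> complex) \<Rightarrow> real" where
  "sq_norm u = (\<Sum>i. (cmod (u i))\<^sup>2)"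

definition herm :: "(nat \<Rightarrow> complex) \<Rightarrow> (nat \<Rightarrow> complex) \<Rightarrow> complex" where
  "herm u v = (\<Sum>i. u i * cnj (v i))"

text \<open>What is left of \<open>u\<close> after subtracting its orthogonal projection onto the
  line spanned by \<open>v\<close>. It is used twice: for \<open>b\<close> against \<open>a\<close>,
  and then for \<open>x\<close> against that first residual.\<close>

definition residual :: "(nat \<Rightarrow> complex) \<Rightarrow> (nat \<Rightarrow> complex) \<Rightarrow> nat \<Rightarrow> complex" where
  "residual u v i = u i - herm u v / complex_of_real (sq_norm v) * v i"

lemma square_summable_sums: "square_summable u \<Longrightarrow> (\<lambda>i. (cmod (u i))\<^sup>2) sums sq_norm u"
  unfolding square_summable_def sq_norm_def by (rule summable_sums)

lemma sq_norm_nonneg: "square_summable u \<Longrightarrow> 0 \<le> sq_norm u"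
  unfolding square_summable_def sq_norm_def by (simp add: suminf_nonneg)

lemma sq_norm_eq_0_iff: "square_summable u \<Longrightarrow> sq_norm u = 0 \<longleftrightarrow> (\<forall>i. u i = 0)"
  unfolding square_summable_def sq_norm_def by (simp add: suminf_eq_zero_iff)

text \<open>Termwise 2|u_i||v_i| \<le> |u_i|^2 + |v_i|^2, so the series converges absolutely by
  comparison.\<close>

lemma herm_sums:
  assumes "square_summable u" and "square_summable v"
  shows "(\<lambda>i. u i * cnj (v i)) sums herm u v"
proof -
  have "summable (\<lambda>i. (cmod (u i))\<^sup>2 + (cmod (v i))\<^sup>2)"
    using assms unfolding square_summable_def by (rule summable_add)
  moreover have "cmod (u i * cnj (v i)) \<le> (cmod (u i))\<^sup>2 + (cmod (v i))\<^sup>2" for i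
  proof -
    have "0 \<le> cmod (u i) * cmod (v i)"
      by simp
    then show ?thesis
      using sum_squares_bound[of "cmod (u i)" "cmod (v i)"] unfolding norm_mult complex_mod_cnj
      by linarith
  qed
  ultimately have "summable (\<lambda>i. u i * cnj (v i))"
    by (rule summable_comparison_test'[where N = 0])
  then show ?thesis
    unfolding herm_def by (rule summable_sums)
qed

text \<open>Swapping the arguments conjugates every term. This reconciles the product of
  \<open>a\<close> with \<open>b\<close> in the inequality with the product of \<open>b\<close> with
  \<open>a\<close> that appears in \<open>residual b a\<close>.\<close>

lemma cmod_herm_commute:
  assumes "square_summable u" and "square_summable v"
  shows "cmod (herm u v) = cmod (herm v u)"
proof -
  have "(\<lambda>i. cnj (v i * cnj (u i))) sums cnj (herm v u)"
    using herm_sums[OF assms(2,1)] by (simp only: sums_cnj)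
  then have "herm u v = cnj (herm v u)"
    using herm_sums[OF assms] by (simp add: mult.commute sums_unique2)
  then show ?thesis
    by simp
qed

text \<open>Pythagoras, by expanding |u_i - m v_i|^2 and summing; with this \<open>m\<close> the
  cross term is twice the quadratic term, so one copy survives with a minus sign. Nonnegativity of
  the sum is Cauchy-Schwarz, and its vanishing is the equality case. The form with
  \<open>sums\<close> yields convergence and value together.\<close>

lemma residual_sq_norm_sums:
  assumes u: "square_summable u" and v: "square_summable v" and "sq_norm v \<noteq> 0"
  shows "(\<lambda>i. (cmod (residual u v i))\<^sup>2) sums (sq_norm u - (cmod (herm u v))\<^sup>2 / sq_norm v)"
proof -
  define m where "m = herm u v / complex_of_real (sq_norm v)"
  have expand: "(cmod (residual u v i))\<^sup>2
      = (cmod (u i))\<^sup>2 - 2 * Re (cnj m * (u i * cnj (v i))) + (cmod m)\<^sup>2 * (cmod (v i))\<^sup>2" for i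
    unfolding residual_def m_def[symmetric] cmod_power2 by (simp add: power2_eq_square algebra_simps)
  have "(\<lambda>i. Re (cnj m * (u i * cnj (v i)))) sums Re (cnj m * herm u v)"
    by (intro sums_Re sums_mult herm_sums u v)
  then have sums: "(\<lambda>i. (cmod (residual u v i))\<^sup>2) sums
      (sq_norm u - 2 * Re (cnj m * herm u v) + (cmod m)\<^sup>2 * sq_norm v)"
    unfolding expand by (intro sums_add sums_diff sums_mult square_summable_sums u v)
  have "Re (cnj m * herm u v) = (cmod (herm u v))\<^sup>2 / sq_norm v"
    unfolding m_def cmod_power2 by (simp add: power2_eq_square add_divide_distrib)
  moreover have "(cmod m)\<^sup>2 * sq_norm v = (cmod (herm u v))\<^sup>2 / sq_norm v"
    unfolding m_def using assms(3) by (simp add: norm_divide power2_eq_square)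
  ultimately show ?thesis
    using sums by simp
qed

lemma square_summable_residual:
  "\<lbrakk>square_summable u; square_summable v; sq_norm v \<noteq> 0\<rbrakk> \<Longrightarrow> square_summable (residual u v)"
  using residual_sq_norm_sums sums_summable unfolding square_summable_def by blast

lemma sq_norm_residual:
  "\<lbrakk>square_summable u; square_summable v; sq_norm v \<noteq> 0\<rbrakk>
    \<Longrightarrow> sq_norm (residual u v) = sq_norm u - (cmod (herm u v))\<^sup>2 / sq_norm v"
  unfolding sq_norm_def[of "residual u v"] by (simp add: residual_sq_norm_sums sums_unique[symmetric])

text \<open>The residual differs from \<open>u\<close> by a multiple of \<open>v\<close>, and
  \<open>w\<close> is orthogonal to \<open>v\<close>.\<close>

lemma herm_residual_right:
  assumes w: "square_summable w" and u: "square_summable u" and v: "square_summable v"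
    and "herm w v = 0"
  shows "herm w (residual u v) = herm w u"
proof -
  define m where "m = herm u v / complex_of_real (sq_norm v)"
  have "(\<lambda>i. w i * cnj (u i) - cnj m * (w i * cnj (v i))) sums (herm w u - cnj m * herm w v)"
    by (intro sums_diff sums_mult herm_sums w u v)
  moreover have "w i * cnj (residual u v i) = w i * cnj (u i) - cnj m * (w i * cnj (v i))" for i
    unfolding residual_def m_def by (simp add: algebra_simps)
  ultimately show ?thesis
    using assms(4) unfolding herm_def[of w "residual u v"] by (simp add: sums_unique[symmetric])
qed

lemma herm_mult_self:
  assumes "square_summable v"
  shows "herm (\<lambda>i. c * v i) v = c * complex_of_real (sq_norm v)"
proof -
  have "(\<lambda>i. c * complex_of_real ((cmod (v i))\<^sup>2)) sums (c * complex_of_real (sq_norm v))"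
    by (intro sums_mult sums_of_real square_summable_sums assms)
  moreover have "c * complex_of_real ((cmod (v i))\<^sup>2) = c * v i * cnj (v i)" for i
    by (simp only: complex_norm_square mult.assoc)
  ultimately show ?thesis
    unfolding herm_def by (simp only: sums_unique[symmetric])
qed

text \<open>For K = \<real> this keeps projection coefficients, and hence the scalar \<nu>, inside
  the field.\<close>

lemma herm_Reals:
  assumes "square_summable u" and "square_summable v" and "\<And>i. u i \<in> \<real>" and "\<And>i. v i \<in> \<real>"
  shows "herm u v \<in> \<real>"
proof -
  have "(\<lambda>i. Im (u i * cnj (v i))) sums Im (herm u v)"
    by (intro sums_Im herm_sums assms)
  moreover have "Im (u i * cnj (v i)) = 0" for i
    using assms(3,4)[of i] by (simp add: complex_is_Real_iff)
  ultimately show ?thesis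
    by (auto simp only: complex_is_Real_iff dest: sums_unique2[OF sums_zero])
qed

theorem mainTheorem2:
  fixes K :: "complex set" and a b x :: "nat \<Rightarrow> complex"
  assumes K: "K = \<real> \<or> K = UNIV"
    and a: "a \<in> ell2 K" and b: "b \<in> ell2 K" and x: "x \<in> ell2 K"
    and indep: "lin_indep_pair K a b"
    and orth: "(\<Sum>i. x i * cnj (a i)) = 0"
    and unit: "(\<Sum>i. (cmod (x i))\<^sup>2) = 1"
  shows "((\<Sum>i. (cmod (a i))\<^sup>2) * (\<Sum>i. (cmod (b i))\<^sup>2) - (cmod (\<Sum>i. a i * cnj (b i)))\<^sup>2)
            / (\<Sum>i. (cmod (a i))\<^sup>2)
           \<ge> (cmod (\<Sum>i. x i * cnj (b i)))\<^sup>2 \<and>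
         (((\<Sum>i. (cmod (a i))\<^sup>2) * (\<Sum>i. (cmod (b i))\<^sup>2) - (cmod (\<Sum>i. a i * cnj (b i)))\<^sup>2)
            / (\<Sum>i. (cmod (a i))\<^sup>2)
           = (cmod (\<Sum>i. x i * cnj (b i)))\<^sup>2
          \<longleftrightarrow>
          (\<exists>\<nu>\<in>K.
             cmod \<nu> = sqrt (\<Sum>k. (cmod (a k))\<^sup>2)
               / sqrt ((\<Sum>k. (cmod (a k))\<^sup>2) * (\<Sum>k. (cmod (b k))\<^sup>2)
                       - (cmod (\<Sum>k. a k * cnj (b k)))\<^sup>2) \<and>
             (\<forall>i. x i = \<nu> * (b i - (\<Sum>k. cnj (a k) * b k)
                                   / complex_of_real (\<Sum>k. (cmod (a k))\<^sup>2) * a i))))"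
proof -
  have sa: "square_summable a" and sb: "square_summable b" and sx: "square_summable x"
    using a b x by (simp_all add: ell2_def square_summable_def)
  have inK: "a i \<in> K" "b i \<in> K" "x i \<in> K" for i
    using a b x by (simp_all add: ell2_def)
  have 01: "0 \<in> K" "1 \<in> K"
    using K by auto
  have herm_K: "herm u v / complex_of_real r \<in> K"
    if "square_summable u" "square_summable v" "\<And>i. u i \<in> K" "\<And>i. v i \<in> K" for u v r
    using K herm_Reals[OF that(1,2)] that(3,4) by auto
  define A where "A = sq_norm a"
  \<comment> \<open>The Gram determinant of \<open>a\<close> and \<open>b\<close>.\<close>
  define D where "D = A * sq_norm b - (cmod (herm b a))\<^sup>2"
  define c where "c = residual b a"
  define C where "C = sq_norm c"
  have A0: "A \<noteq> 0"
  proof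
    assume "A = 0"
    then have "\<forall>i. 1 * a i + 0 * b i = 0"
      using sq_norm_eq_0_iff[OF sa] by (simp add: A_def)
    then show False
      using indep 01 unfolding lin_indep_pair_def by (metis zero_neq_one)
  qed
  then have "A > 0"
    using sq_norm_nonneg[OF sa] by (simp add: A_def)
  have sc: "square_summable c"
    using square_summable_residual[OF sb sa] A0 by (simp add: A_def c_def)
  have cK: "c i \<in> K" for i
    using K inK(1,2)[of i] herm_K[OF sb sa inK(2,1)] unfolding c_def residual_def
    by (metis Reals_diff Reals_mult UNIV_I)
  have "C \<noteq> 0"
  proof
    define m where "m = herm b a / complex_of_real (sq_norm a)"
    assume "C = 0"
    \<comment> \<open>A vanishing residual makes \<open>b\<close> equal to \<open>m\<close> times
      \<open>a\<close>, a nontrivial relation with coefficients in \<open>K\<close>.\<close>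
    then have "\<forall>i. (- m) * a i + 1 * b i = 0"
      using sq_norm_eq_0_iff[OF sc] by (simp add: C_def c_def residual_def m_def)
    moreover have "- m \<in> K"
      using K herm_K[OF sb sa inK(2,1)] by (auto simp: m_def)
    ultimately show False
      using indep 01 unfolding lin_indep_pair_def by (metis zero_neq_one)
  qed
  then have "C > 0"
    using sq_norm_nonneg[OF sc] by (simp add: C_def)
  have C_eq: "C = D / A"
    using sq_norm_residual[OF sb sa] A0 by (simp add: C_def c_def D_def A_def diff_divide_distrib)
  have xb: "herm x c = herm x b"
    unfolding c_def using orth by (intro herm_residual_right sx sb sa) (simp add: herm_def)
  \<comment> \<open>The prescribed modulus of \<nu> is the reciprocal of the norm of
    \<open>c\<close>, which is what makes \<nu> times \<open>c\<close> a unit vector.\<close>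
  have scale: "sqrt A / sqrt D = 1 / sqrt C"
    using \<open>A > 0\<close> \<open>C > 0\<close> by (simp add: C_eq real_sqrt_divide)
  have sx': "square_summable (residual x c)"
    using square_summable_residual[OF sx sc] \<open>C \<noteq> 0\<close> by (simp add: C_def)
  \<comment> \<open>The squared distance from \<open>x\<close> to the line spanned by
    \<open>c\<close>: its sign gives the inequality, its vanishing the equality case.\<close>
  have defect: "sq_norm (residual x c) = 1 - (cmod (herm x b))\<^sup>2 / C"
    using sq_norm_residual[OF sx sc] \<open>C \<noteq> 0\<close> unit by (simp add: C_def xb sq_norm_def[of x])
  have ineq: "(cmod (herm x b))\<^sup>2 \<le> C"
    using sq_norm_nonneg[OF sx'] \<open>C > 0\<close> by (simp add: defect)
  have eq_iff: "C = (cmod (herm x b))\<^sup>2 \<longleftrightarrow>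
      (\<exists>\<nu>\<in>K. cmod \<nu> = sqrt A / sqrt D \<and> (\<forall>i. x i = \<nu> * c i))"
  proof
    assume eq: "C = (cmod (herm x b))\<^sup>2"
    \<comment> \<open>The coefficient of the projection of \<open>x\<close> onto \<open>c\<close>;
      in the equality case its modulus is \<open>sqrt C / C\<close>.\<close>
    define \<nu> where "\<nu> = herm x c / complex_of_real C"
    have "\<nu> \<in> K"
      unfolding \<nu>_def by (intro herm_K sx sc inK cK)
    moreover have "cmod (herm x b) = sqrt C"
      using eq by simp
    then have "cmod \<nu> = sqrt A / sqrt D"
      using \<open>C > 0\<close> by (simp add: \<nu>_def xb norm_divide scale real_div_sqrt divide_simps)
    moreover have "sq_norm (residual x c) = 0"
      using eq \<open>C \<noteq> 0\<close> by (simp add: defect)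
    then have "\<forall>i. x i = \<nu> * c i"
      using sq_norm_eq_0_iff[OF sx'] by (simp add: residual_def \<nu>_def C_def)
    ultimately show "\<exists>\<nu>\<in>K. cmod \<nu> = sqrt A / sqrt D \<and> (\<forall>i. x i = \<nu> * c i)"
      by blast
  next
    assume "\<exists>\<nu>\<in>K. cmod \<nu> = sqrt A / sqrt D \<and> (\<forall>i. x i = \<nu> * c i)"
    then obtain \<nu> where \<nu>: "cmod \<nu> = 1 / sqrt C" and "x = (\<lambda>i. \<nu> * c i)"
      unfolding scale by blast
    \<comment> \<open>Pairing \<open>x\<close> with \<open>c\<close> instead of \<open>b\<close>
      leaves only the squared norm of \<open>c\<close>; since |\<nu>|^2 = 1/C, the squared modulus
      is C^2/C = C.\<close>
    then have "herm x b = \<nu> * complex_of_real C"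
      using herm_mult_self[OF sc, of \<nu>] xb by (simp add: C_def)
    then show "C = (cmod (herm x b))\<^sup>2"
      using \<open>C > 0\<close> by (simp add: norm_mult \<nu> power_mult_distrib power_divide power2_eq_square)
  qed
  have "(\<Sum>k. cnj (a k) * b k) = herm b a"
    by (simp add: herm_def mult.commute)
  then show ?thesis
    using ineq eq_iff cmod_herm_commute[OF sa sb] unfolding C_eq D_def A_def c_def residual_def
    by (simp add: herm_def[of a b] herm_def[of x b] sq_norm_def)
qed

end
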